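(* Let $G=(U,A)$ be a finite digraph and let $H=G\boxtimes K_2$. Let $F_0$ be a rooted forest of $H$, and let $S\subseteq U$ be the set of vertices $u$ of $G$ such that $F_0$ contains a vertical arc at $u$. Let $F$ be a uniformly random rooted forest of $H$ conditioned to have the same $G$-projection as $F_0$. For each $u\in S$, let $\sigma_u\in\{0,1\}$ be the spin of the vertical arc at $u$ of $F$. Then the random variables $\sigma_u$, $u\in S$, are independent and each is uniformly distributed on $\{0,1\}$.
   Context: A digraph is a finite directed graph $G=(U,A)$; an arc $a=(u,v)$ goes from $u$ to $v$. A rooted forest of a digraph is a subgraph containing every vertex, containing no cycle, and such that each vertex has at most one outgoing arc in it; vertices with no outgoing arc are root vertices (so each component is a tree directed toward its unique root). $K_2$ is the digraph with vertex set $\{0,1\}$ and the two arcs $(0,1)$ and $(1,0)$. The strong product $H=G\boxtimes K_2$ has vertex set $U\times\{0,1\}$ and the following arcs: for each arc $a=(u,v)\in A$ and $\varepsilon\in\{0,1\}$, a straight $a$-arc from $(u,\varepsilon)$ to $(v,\varepsilon)$ and a diagonal $a$-arc from $(u,\varepsilon)$ to $(v,1-\varepsilon)$; and for each $u\in U$ and $\varepsilon\in\{0,1\}$, a vertical arc of spin $\varepsilon$ at $u$ going from $(u,1-\varepsilon)$ to $(u,\varepsilon)$. Two rooted forests of $H$ have the same $G$-projection if for every $a\in A$ they contain the same number of straight $a$-arcs and the same number of diagonal $a$-arcs, and they contain vertical arcs at exactly the same set of vertices of $G$. *)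

theory Defs
  imports
    "HOL-Probability.Probability"
    "HOL-Library.Z2"
    "Graph_Theory.Graph_Theory"
begin

text \<open>
  The vertex set \<open>{0, 1}\<close> of the digraph \<open>K\<^sub>2\<close> is the type \<^typ>\<open>bit\<close>, in which
  \<open>1 - \<epsilon>\<close> is the element other than \<open>\<epsilon>\<close>.

  The arcs of the product are labelled by their origin. A diagonal arc coming from a loop
  at \<open>u\<close> thereby stays distinct from the vertical arc at \<open>u\<close> with the same ends, and
  parallel arcs of \<open>G\<close> give distinct arcs of the product. The argument \<open>\<epsilon>\<close> of
  \<open>Straight\<close> and \<open>Diagonal\<close> is the level of the tail; that of \<open>Vertical\<close> is the spin,
  which is the level of the head.
\<close>

datatype ('a, 'b) prod_arc = Straight 'b bit | Diagonal 'b bit | Vertical 'a bit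

definition strong_prod_K2 ::
  "('a, 'b) pre_digraph \<Rightarrow> ('a \<times> bit, ('a, 'b) prod_arc) pre_digraph"
where
  "strong_prod_K2 G = \<lparr>
     verts = verts G \<times> {0, 1},
     arcs = {Straight a \<epsilon> | a \<epsilon>. a \<in> arcs G \<and> \<epsilon> \<in> {0, 1}}
          \<union> {Diagonal a \<epsilon> | a \<epsilon>. a \<in> arcs G \<and> \<epsilon> \<in> {0, 1}}
          \<union> {Vertical u \<epsilon> | u \<epsilon>. u \<in> verts G \<and> \<epsilon> \<in> {0, 1}},
     tail = (\<lambda>e. case e of
         Straight a \<epsilon> \<Rightarrow> (tail G a, \<epsilon>)
       | Diagonal a \<epsilon> \<Rightarrow> (tail G a, \<epsilon>)
       | Vertical u \<epsilon> \<Rightarrow> (u, 1 - \<epsilon>)),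
     head = (\<lambda>e. case e of
         Straight a \<epsilon> \<Rightarrow> (head G a, \<epsilon>)
       | Diagonal a \<epsilon> \<Rightarrow> (head G a, 1 - \<epsilon>)
       | Vertical u \<epsilon> \<Rightarrow> (u, \<epsilon>)) \<rparr>"

text \<open>
  The library predicate \<^const>\<open>forest\<close> excludes directed cycles, loops included. As every
  vertex has at most one outgoing arc, a cycle of the underlying undirected graph would be a
  directed cycle, so this is acyclicity in either sense.
\<close>

definition rooted_forest :: "('v, 'e) pre_digraph \<Rightarrow> ('v, 'e) pre_digraph \<Rightarrow> bool" where
  "rooted_forest H F \<longleftrightarrow>
     spanning F H \<and> forest F \<and> (\<forall>v \<in> verts F. out_degree F v \<le> 1)"

definition vertical_set :: "('a \<times> bit, ('a, 'b) prod_arc) pre_digraph \<Rightarrow> 'a set" where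
  "vertical_set F = {u. \<exists>\<epsilon>. Vertical u \<epsilon> \<in> arcs F}"

definition same_projection ::
  "('a, 'b) pre_digraph \<Rightarrow> ('a \<times> bit, ('a, 'b) prod_arc) pre_digraph
    \<Rightarrow> ('a \<times> bit, ('a, 'b) prod_arc) pre_digraph \<Rightarrow> bool"
where
  "same_projection G F F' \<longleftrightarrow>
     (\<forall>a \<in> arcs G.
        card {e \<in> arcs F. \<exists>\<epsilon>. e = Straight a \<epsilon>} = card {e \<in> arcs F'. \<exists>\<epsilon>. e = Straight a \<epsilon>} \<and>
        card {e \<in> arcs F. \<exists>\<epsilon>. e = Diagonal a \<epsilon>} = card {e \<in> arcs F'. \<exists>\<epsilon>. e = Diagonal a \<epsilon>}) \<and>
     vertical_set F = vertical_set F'"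

text \<open>
  The description is proper for a rooted forest \<open>F\<close> and \<open>u \<in> vertical_set F\<close>, since the two
  vertical arcs at \<open>u\<close> form a directed cycle.
\<close>

definition spin :: "('a \<times> bit, ('a, 'b) prod_arc) pre_digraph \<Rightarrow> 'a \<Rightarrow> bit" where
  "spin F u = (THE \<epsilon>. Vertical u \<epsilon> \<in> arcs F)"

text \<open>
  \<^const>\<open>pmf_of_set\<close> is meaningful only for finite nonempty sets: here, \<open>G\<close> is finite and
  \<open>F\<^sub>0\<close> itself is in the set.
\<close>

definition random_forest ::
  "('a, 'b) pre_digraph \<Rightarrow> ('a \<times> bit, ('a, 'b) prod_arc) pre_digraph
    \<Rightarrow> ('a \<times> bit, ('a, 'b) prod_arc) pre_digraph pmf"
where
  "random_forest G F\<^sub>0 =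
     pmf_of_set {F. rooted_forest (strong_prod_K2 G) F \<and> same_projection G F F\<^sub>0}"

end

theory Submission
  imports Defs "Jordan_Normal_Form.Determinant"
begin

text \<open>
  A forest is an acyclic set of arcs with at most one arc out of each vertex, and for an arc set of
  the latter kind the determinant of (identity minus adjacency matrix) is 1 or 0 according to
  whether it is acyclic. Reflecting in the second factor all arcs that leave the two vertices above
  \<open>u\<close> preserves the projection and flips the spin at \<open>u\<close>, if there is one. Now sum the determinant
  over all reflections above vertices outside \<open>S\<close>. In the exterior algebra, each pair of rows outside
  \<open>S\<close> then contributes at least one row that is antisymmetric under the reflection, and so does
  every vertical arc; flipping a spin changes the sum by a determinant with one further
  antisymmetric row. There are only \<open>card U\<close> independent antisymmetric rows, so the sum does not
  depend on the spins, and hence neither does the number of forests with given spins.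
\<close>

section \<open>Determinants indexed by a finite set\<close>

lemma permutes_less_nat:
  assumes "p permutes {0..<n}" "i < n" shows "p i < (n::nat)"
  using permutes_in_image[OF assms(1), of i] assms(2) by simp

text \<open>Rows and columns are numbered by the same enumeration of \<open>V\<close>, so for finite
  \<open>V\<close> the value does not depend on the enumeration.\<close>

definition fdet :: "'i set \<Rightarrow> ('i \<Rightarrow> 'i \<Rightarrow> real) \<Rightarrow> real" where
  "fdet V A = Determinant.det (mat (card V) (card V)
     (\<lambda>(i, j). A (from_nat_into V i) (from_nat_into V j)))"

lemma from_nat_into_less_card:
  assumes "i < card V" shows "from_nat_into V i \<in> V"
  using assms by (metis card.empty from_nat_into not_less0)

lemma from_nat_into_eq_iff:
  assumes "finite V" "i < card V" "j < card V"
  shows "from_nat_into V i = from_nat_into V j \<longleftrightarrow> i = j"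
  using bij_betw_from_nat_into_finite[OF assms(1)] assms(2,3)
  by (auto simp: bij_betw_def inj_on_def)

lemma obtain_index:
  assumes "finite V" "v \<in> V"
  obtains i where "i < card V" "from_nat_into V i = v"
proof -
  have "v \<in> from_nat_into V ` {..<card V}"
    using bij_betw_from_nat_into_finite[OF assms(1)] assms(2) by (simp add: bij_betw_def)
  then show ?thesis using that by auto
qed

lemma sum_index:
  assumes "finite V"
  shows "(\<Sum>i = 0..<card V. f (from_nat_into V i)) = (\<Sum>v\<in>V. f v)"
  using sum.reindex_bij_betw[OF bij_betw_from_nat_into_finite[OF assms], of f]
  by (simp add: atLeast0LessThan)

lemma fdet_leibniz:
  "fdet V A = (\<Sum>p | p permutes {0..<card V}. signof p *
     (\<Prod>i = 0..<card V. A (from_nat_into V i) (from_nat_into V (p i))))"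
  unfolding fdet_def
  by (subst det_def'[where n = "card V"])
     (auto intro!: sum.cong prod.cong simp: permutes_less_nat)

lemma fdet_row_add:
  assumes "finite V" "k \<in> V"
  shows "fdet V (A(k := \<lambda>x. a x + b x)) = fdet V (A(k := a)) + fdet V (A(k := b))"
proof -
  obtain i where i: "i < card V" and k: "from_nat_into V i = k"
    using obtain_index[OF assms] .
  define rest where "rest p = (\<Prod>j\<in>{0..<card V} - {i}. A (from_nat_into V j) (from_nat_into V (p j)))"
    for p
  have "(\<Prod>j = 0..<card V. (A(k := r)) (from_nat_into V j) (from_nat_into V (p j)))
      = r (from_nat_into V (p i)) * rest p" for r p
  proof -
    have "(\<Prod>j\<in>{0..<card V} - {i}. (A(k := r)) (from_nat_into V j) (from_nat_into V (p j))) = rest p"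
      unfolding rest_def
    proof (rule prod.cong[OF refl])
      fix j assume "j \<in> {0..<card V} - {i}"
      then have "from_nat_into V j \<noteq> k"
        using from_nat_into_eq_iff[OF assms(1), of j i] i k by auto
      then show "(A(k := r)) (from_nat_into V j) (from_nat_into V (p j))
        = A (from_nat_into V j) (from_nat_into V (p j))" by simp
    qed
    then show ?thesis
      using i k by (subst prod.remove[of _ i]) auto
  qed
  then show ?thesis
    by (simp add: fdet_leibniz sum.distrib[symmetric] distrib_left distrib_right)
qed

lemma fdet_swap_rows:
  assumes "finite V" "k \<in> V" "l \<in> V" "k \<noteq> l"
  shows "fdet V (A(k := A l, l := A k)) = - fdet V A"
proof -
  obtain i where i: "i < card V" and k: "from_nat_into V i = k"
    using obtain_index[OF assms(1,2)] .
  obtain j where j: "j < card V" and l: "from_nat_into V j = l"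
    using obtain_index[OF assms(1,3)] .
  let ?M = "mat (card V) (card V) (\<lambda>(i, j). A (from_nat_into V i) (from_nat_into V j))"
  have "mat (card V) (card V) (\<lambda>(i, j). (A(k := A l, l := A k)) (from_nat_into V i) (from_nat_into V j))
      = swaprows i j ?M"
    using assms(4) i j k l from_nat_into_eq_iff[OF assms(1)]
    by (auto simp: mat_swaprows_def intro!: eq_matI)
  then show ?thesis
    using det_swaprows[OF i j, of ?M] assms(4) k l by (auto simp: fdet_def)
qed

section \<open>Kernel vectors, and the determinant of a functional digraph\<close>

lemma fdet_eq_0_of_kernel:
  assumes "finite V" "w \<in> V" "y w \<noteq> 0"
    and "\<And>v. v \<in> V \<Longrightarrow> (\<Sum>x\<in>V. A v x * y x) = 0"
  shows "fdet V A = 0"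
proof -
  let ?M = "mat (card V) (card V) (\<lambda>(i, j). A (from_nat_into V i) (from_nat_into V j))"
  let ?y = "Matrix.vec (card V) (\<lambda>i. y (from_nat_into V i))"
  obtain i where i: "i < card V" and w: "from_nat_into V i = w"
    using obtain_index[OF assms(1,2)] .
  have "?y \<noteq> 0\<^sub>v (card V)"
    using i w assms(3) by (auto simp: vec_eq_iff)
  moreover have "?M *\<^sub>v ?y = 0\<^sub>v (card V)"
  proof (rule eq_vecI)
    fix k assume k: "k < dim_vec (0\<^sub>v (card V) :: real Matrix.vec)"
    then have "vec_index (?M *\<^sub>v ?y) k
        = (\<Sum>j = 0..<card V. A (from_nat_into V k) (from_nat_into V j) * y (from_nat_into V j))"
      by (simp add: scalar_prod_def)
    also have "\<dots> = (\<Sum>x\<in>V. A (from_nat_into V k) x * y x)"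
      by (rule sum_index[OF assms(1)])
    also have "\<dots> = 0" using assms(4) from_nat_into_less_card k by auto
    finally show "vec_index (?M *\<^sub>v ?y) k = vec_index (0\<^sub>v (card V)) k" using k by simp
  qed simp
  ultimately show ?thesis
    unfolding fdet_def
    by (subst det_0_iff_vec_prod_zero_field[where n = "card V"]) (auto intro!: exI[of _ ?y])
qed

text \<open>The system is padded with zero rows to a square one. Its determinant vanishes, which
  yields a nonzero solution.\<close>

lemma underdetermined_system:
  fixes R :: "'e \<Rightarrow> 'c \<Rightarrow> real"
  assumes "finite E" "finite C" "card E < card C"
  obtains y c where "c \<in> C" "y c \<noteq> 0" "\<And>e. e \<in> E \<Longrightarrow> (\<Sum>c\<in>C. R e c * y c) = 0"
proof -
  let ?n = "card C"
  let ?row = "\<lambda>i. Matrix.vec ?n (\<lambda>j. if i < card E then R (from_nat_into E i) (from_nat_into C j) else 0)"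
  \<comment> \<open>Row \<open>card E\<close> exists because \<open>card E < card C\<close>; it is
    written as the zero vector so that \<open>det_row_0\<close> applies.\<close>
  let ?M = "mat\<^sub>r ?n ?n (\<lambda>i. if i = card E then 0\<^sub>v ?n else ?row i)"
  have "Determinant.det ?M = 0"
    by (rule det_row_0[OF assms(3)]) auto
  then obtain z where z: "z \<in> carrier_vec ?n" "z \<noteq> 0\<^sub>v ?n" "?M *\<^sub>v z = 0\<^sub>v ?n"
    using det_0_iff_vec_prod_zero_field[of ?M ?n] by auto
  define y where "y c = vec_index z (the_inv_into {..<?n} (from_nat_into C) c)" for c
  have y: "y (from_nat_into C j) = vec_index z j" if "j < ?n" for j
    using that bij_betw_from_nat_into_finite[OF assms(2)]
    by (simp add: y_def bij_betw_def the_inv_into_f_f)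
  obtain j where j: "j < ?n" "vec_index z j \<noteq> 0"
    using z(1,2) by (auto simp: vec_eq_iff)
  have "(\<Sum>c\<in>C. R e c * y c) = 0" if e: "e \<in> E" for e
  proof -
    obtain i where i: "i < card E" "from_nat_into E i = e"
      using obtain_index[OF assms(1) e] .
    have "(\<Sum>c\<in>C. R e c * y c)
        = (\<Sum>j = 0..<?n. R e (from_nat_into C j) * vec_index z j)"
      by (subst sum_index[OF assms(2), symmetric]) (simp add: y)
    also have "\<dots> = vec_index (?M *\<^sub>v z) i"
      using i assms(3) z(1) by (simp add: scalar_prod_def)
    also have "\<dots> = 0" using z(3) i assms(3) by simp
    finally show ?thesis .
  qed
  then show ?thesis
    using that[of "from_nat_into C j" y] j y[OF j(1)] from_nat_into_less_card[OF j(1)] by simp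
qed

text \<open>A directed cycle gives a nonzero kernel vector. Without cycles only the identity
  permutation contributes to the Leibniz sum, and its product is 1 because there are no
  loops.\<close>

lemma fdet_functional_digraph:
  assumes "finite V" "E \<subseteq> V \<times> V" "single_valued E"
  shows "fdet V (\<lambda>v x. of_bool (x = v) - of_bool ((v, x) \<in> E)) = of_bool (acyclic E)"
proof (cases "acyclic E")
  case False
  \<comment> \<open>The kernel vector is the indicator of the vertices from which a directed cycle
    can be reached. It takes equal values at a vertex and its only successor, and vanishes at a
    vertex without successor.\<close>
  define y :: "'a \<Rightarrow> real" where "y x = of_bool (\<exists>c. (x, c) \<in> E\<^sup>* \<and> (c, c) \<in> E\<^sup>+)" for x
  from False obtain w where w: "(w, w) \<in> E\<^sup>+" by (auto simp: acyclic_def)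
  then have "w \<in> V" using assms(2) by (meson SigmaD1 subsetD tranclD)
  moreover have "y w \<noteq> 0" using w by (auto simp: y_def)
  moreover have "(\<Sum>x\<in>V. (of_bool (x = v) - of_bool ((v, x) \<in> E)) * y x) = 0" if "v \<in> V" for v
  proof -
    have "(\<Sum>x\<in>V. of_bool ((v, x) \<in> E) * y x) = y v"
    proof (cases "\<exists>x. (v, x) \<in> E")
      case True
      then obtain x where x: "(v, x) \<in> E" by auto
      then have iff: "(v, z) \<in> E \<longleftrightarrow> z = x" for z
        using assms(3) by (auto dest: single_valuedD)
      have step: "(x, c) \<in> E\<^sup>*" if "(v, c) \<in> E\<^sup>+" for c
        using tranclD[OF that] iff by auto
      have "y v = y x"
      proof -
        \<comment> \<open>In the case \<open>c = v\<close> the cycle through \<open>v\<close> leaves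
          it along the only arc, so \<open>v\<close> is reachable from \<open>x\<close>.\<close>
        have "(v, c) \<in> E\<^sup>* \<and> (c, c) \<in> E\<^sup>+ \<longleftrightarrow> (x, c) \<in> E\<^sup>* \<and> (c, c) \<in> E\<^sup>+" for c
          using x step[of c] by (auto intro: converse_rtrancl_into_rtrancl dest: rtranclD)
        then show ?thesis unfolding y_def by simp
      qed
      moreover have "x \<in> V" using x assms(2) by auto
      ultimately show ?thesis using assms(1) by (simp add: iff if_distrib sum.delta)
    next
      case False
      then have "y v = 0"
        by (auto simp: y_def elim: converse_rtranclE dest: tranclD)
      with False show ?thesis by simp
    qed
    moreover have "(\<Sum>x\<in>V. of_bool (x = v) * y x) = y v"
      using that assms(1) by (simp add: sum.delta)
    ultimately show ?thesis by (simp add: left_diff_distrib sum_subtractf)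
  qed
  ultimately have "fdet V (\<lambda>v x. of_bool (x = v) - of_bool ((v, x) \<in> E)) = 0"
    by (rule fdet_eq_0_of_kernel[OF assms(1)])
  with False show ?thesis by simp
next
  case True
  \<comment> \<open>The number of vertices reachable in at least one step is a rank that drops along
    every arc: \<open>x\<close> is counted for \<open>v\<close>, but not for itself.\<close>
  define r where "r v = card {x. (v, x) \<in> E\<^sup>+}" for v
  have E: "E\<^sup>+ \<subseteq> V \<times> V" using assms(2) by (rule trancl_subset_Sigma)
  have r: "r x < r v" if "(v, x) \<in> E" for v x
    unfolding r_def
  proof (rule psubset_card_mono)
    show "finite {x. (v, x) \<in> E\<^sup>+}" using assms(1) E by (auto intro: finite_subset)
    show "{z. (x, z) \<in> E\<^sup>+} \<subset> {z. (v, z) \<in> E\<^sup>+}"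
      using that True by (auto simp: acyclic_def intro: trancl_into_trancl2)
  qed
  let ?h = "from_nat_into V"
  let ?A = "\<lambda>v x. of_bool (x = v) - of_bool ((v, x) \<in> E) :: real"
  \<comment> \<open>In a nonvanishing term each index stays fixed or moves along an arc. If some
    index moved, the total rank would fall, yet a permutation leaves it unchanged.\<close>
  have zero: "(\<Prod>i = 0..<card V. ?A (?h i) (?h (p i))) = 0"
    if p: "p permutes {0..<card V}" and "p \<noteq> id" for p
  proof (rule ccontr)
    assume "(\<Prod>i = 0..<card V. ?A (?h i) (?h (p i))) \<noteq> 0"
    then have nz: "?A (?h i) (?h (p i)) \<noteq> 0" if "i < card V" for i using that by auto
    have step: "p i = i \<or> (?h i, ?h (p i)) \<in> E" if "i < card V" for i
      using nz[OF that] from_nat_into_eq_iff[OF assms(1), of "p i" i]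
        permutes_less_nat[OF p that] that by (auto split: if_splits)
    have le: "r (?h (p i)) \<le> r (?h i)" if "i < card V" for i
      using step[OF that] r[of "?h i" "?h (p i)"] by auto
    obtain i where i: "p i \<noteq> i" using \<open>p \<noteq> id\<close> by (auto simp: fun_eq_iff)
    then have "i < card V" using permutes_not_in[OF p, of i] by fastforce
    have "(\<Sum>i = 0..<card V. r (?h (p i))) < (\<Sum>i = 0..<card V. r (?h i))"
      using i step[OF \<open>i < card V\<close>] \<open>i < card V\<close> r le by (intro sum_strict_mono_ex1) (auto intro!: bexI[of _ i])
    moreover have "(\<Sum>i = 0..<card V. r (?h (p i))) = (\<Sum>i = 0..<card V. r (?h i))"
      using sum.permute[OF p, of "r \<circ> ?h"] by (simp add: o_def)
    ultimately show False by simp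
  qed
  have "(x, x) \<notin> E" for x using True by (auto simp: acyclic_def)
  then have "(\<Prod>i = 0..<card V. ?A (?h i) (?h (id i))) = 1" by simp
  then have "fdet V ?A = (\<Sum>p | p permutes {0..<card V}. if p = id then 1 else 0)"
    unfolding fdet_leibniz using zero by (intro sum.cong) auto
  also have "\<dots> = 1"
    by (subst sum.delta) (auto simp: finite_permutations permutes_id)
  finally show ?thesis using True by simp
qed

lemma fdet_row_diff:
  assumes "finite V" "k \<in> V"
  shows "fdet V (A(k := \<lambda>x. a x - b x)) = fdet V (A(k := a)) - fdet V (A(k := b))"
  using fdet_row_add[OF assms, of A "\<lambda>x. a x - b x" b] by simp

lemma fdet_row_uminus:
  assumes "finite V" "k \<in> V"
  shows "fdet V (A(k := \<lambda>x. - a x)) = - fdet V (A(k := a))"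
proof -
  have "fdet V (A(k := \<lambda>x. 0)) = 0"
    using fdet_row_diff[OF assms, of A a a] by simp
  then show ?thesis using fdet_row_diff[OF assms, of A "\<lambda>x. 0" a] by simp
qed

lemma fdet_swap_two_rows:
  assumes "finite V" "k \<in> V" "l \<in> V" "k \<noteq> l"
  shows "fdet V (A(k := a, l := b)) = - fdet V (A(k := b, l := a))"
  using fdet_swap_rows[OF assms, of "A(k := b, l := a)"] assms(4) by (simp add: fun_upd_twist)

section \<open>Reflection of rows\<close>

lemma UNIV_bit: "(UNIV :: bit set) = {0, 1}"
  by (auto intro: bit.exhaust)

lemma finite_UNIV_bit [simp]: "finite (UNIV :: bit set)"
  by (simp add: UNIV_bit)

lemma one_minus_bit [simp]: "1 - (1 - \<epsilon>) = (\<epsilon> :: bit)"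
  by (cases \<epsilon>) auto

lemma one_minus_bit_neq [simp]: "1 - \<epsilon> \<noteq> (\<epsilon> :: bit)" "\<epsilon> \<noteq> 1 - (\<epsilon> :: bit)"
  by (cases \<epsilon>; simp)+

lemma bit_neq_iff: "\<epsilon> \<noteq> \<delta> \<longleftrightarrow> \<epsilon> = 1 - (\<delta> :: bit)"
  by (cases \<epsilon>; cases \<delta>) auto

definition mirror :: "'a \<times> bit \<Rightarrow> 'a \<times> bit" where
  "mirror v = (fst v, 1 - snd v)"

lemma mirror_Pair [simp]: "mirror (u, \<epsilon>) = (u, 1 - \<epsilon>)"
  by (simp add: mirror_def)

lemma fst_mirror [simp]: "fst (mirror v) = fst v"
  by (simp add: mirror_def)

lemma mirror_mirror [simp]: "mirror (mirror v) = v"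
  by (cases v) simp

lemma mirror_eq_iff [simp]: "mirror v = mirror w \<longleftrightarrow> v = w"
  by (metis mirror_mirror)

lemma mirror_eq_swap: "mirror v = w \<longleftrightarrow> v = mirror w"
  by (metis mirror_mirror)

text \<open>Restricted to the vertices above a finite \<open>U\<close>, these rows form a space of
  dimension \<open>card U\<close>, half of the full dimension.\<close>

definition antisymmetric_row :: "('a \<times> bit \<Rightarrow> real) \<Rightarrow> bool" where
  "antisymmetric_row r \<longleftrightarrow> (\<forall>x. r (mirror x) = - r x)"

lemma antisymmetric_row_diff_mirror: "antisymmetric_row (\<lambda>x. r x - r (mirror x))"
  by (simp add: antisymmetric_row_def)

text \<open>Models the reflection of all arcs leaving the vertices above \<open>t\<close>. As both
  indices are reflected, the identity matrix stays fixed.\<close>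

definition swap_rows :: "'a set \<Rightarrow> ('a \<times> bit \<Rightarrow> 'a \<times> bit \<Rightarrow> real) \<Rightarrow> 'a \<times> bit \<Rightarrow> 'a \<times> bit \<Rightarrow> real"
  where "swap_rows t R v x = (if fst v \<in> t then R (mirror v) (mirror x) else R v x)"

lemma swap_rows_empty [simp]: "swap_rows {} R = R"
  by (simp add: swap_rows_def fun_eq_iff)

lemma swap_rows_upd:
  assumes "fst v \<notin> t"
  shows "swap_rows t (R(v := r)) = (swap_rows t R)(v := r)"
  using assms by (auto simp: swap_rows_def fun_eq_iff dest: arg_cong[where f = fst])

lemma swap_rows_insert:
  assumes "u \<notin> t"
  shows "swap_rows (insert u t) R = (swap_rows t R)
    ((u, \<epsilon>) := \<lambda>x. R (u, 1 - \<epsilon>) (mirror x), (u, 1 - \<epsilon>) := \<lambda>x. R (u, \<epsilon>) (mirror x))"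
  using assms bit_neq_iff by (force simp: swap_rows_def fun_eq_iff)

section \<open>Cancellation in sums of determinants over reflections\<close>

lemma sum_Pow_insert:
  assumes "finite T" "w \<notin> T"
  shows "(\<Sum>t\<in>Pow (insert w T). f t) = (\<Sum>t\<in>Pow T. f t + f (insert w t))"
proof -
  have "inj_on (insert w) (Pow T)"
    using assms(2) by (auto simp: inj_on_def)
  moreover have "Pow T \<inter> insert w ` Pow T = {}" using assms(2) by auto
  ultimately show ?thesis
    using assms(1) by (simp add: Pow_insert sum.union_disjoint sum.reindex sum.distrib)
qed

text \<open>Antisymmetric rows annihilate every reflection-invariant vector. Such vectors form a
  space of dimension \<open>card U\<close>, and the remaining rows, fewer than
  \<open>card U\<close>, leave a nonzero one in the kernel.\<close>

lemma fdet_eq_0_of_antisymmetric_rows: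
  assumes "finite U" "I \<subseteq> U \<times> UNIV" "card U < card I"
    and "\<And>v. v \<in> I \<Longrightarrow> antisymmetric_row (R v)"
  shows "fdet (U \<times> UNIV) R = 0"
proof -
  let ?V = "U \<times> (UNIV :: bit set)"
  have V: "finite ?V" using assms(1) by simp
  have "card ?V = card U * 2"
    by (simp add: card_cartesian_product UNIV_bit)
  moreover have "card (?V - I) = card ?V - card I"
    using finite_subset[OF assms(2) V] assms(2) by (rule card_Diff_subset)
  moreover have "card I \<le> card ?V"
    using V assms(2) by (rule card_mono)
  ultimately have less: "card (?V - I) < card U"
    using assms(3) by linarith
  \<comment> \<open>\<open>y c\<close> is the common value of the invariant vector at the two points
    above \<open>c\<close>.\<close>
  obtain y c where c: "c \<in> U" "y c \<noteq> 0"
    and y: "\<And>v. v \<in> ?V - I \<Longrightarrow> (\<Sum>c\<in>U. (R v (c, 0) + R v (c, 1)) * y c) = 0"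
    by (rule underdetermined_system[OF finite_Diff[OF V] assms(1) less,
        where R = "\<lambda>v c. R v (c, 0) + R v (c, 1)"]) blast
  have "(\<Sum>x\<in>?V. R v x * y (fst x)) = 0" if v: "v \<in> ?V" for v
  proof -
    have "(\<Sum>x\<in>?V. R v x * y (fst x)) = (\<Sum>c\<in>U. \<Sum>\<epsilon>\<in>UNIV. R v (c, \<epsilon>) * y c)"
      by (simp add: sum.cartesian_product case_prod_beta)
    also have "\<dots> = (\<Sum>c\<in>U. (R v (c, 0) + R v (c, 1)) * y c)"
      by (simp add: UNIV_bit distrib_right)
    also have "\<dots> = 0"
    proof (cases "v \<in> I")
      case True
      then have "R v (mirror (c, 0)) = - R v (c, 0)" for c
        using assms(4) unfolding antisymmetric_row_def by blast
      then show ?thesis by simp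
    qed (use v y in auto)
    finally show ?thesis .
  qed
  then show ?thesis
    using assms(1) c by (intro fdet_eq_0_of_kernel[of _ "(c, 0)" "\<lambda>x. y (fst x)"]) auto
qed

text \<open>
  Writing \<open>r'\<close> for the mirror image of a row \<open>r\<close> and \<open>\<and>\<close> for the exterior product, the two orders of the rows at \<open>w\<close> add up to
  \<open>p \<and> q + q' \<and> p' = p \<and> (q - q') + (p - p') \<and> q'\<close>, so each summand on the right has an additional
  antisymmetric row.
\<close>

lemma sum_fdet_swap_rows_eq_0:
  assumes "finite U" "T \<subseteq> U" "I \<subseteq> (U - T) \<times> UNIV" "card (U - T) < card I"
    and "\<And>v. v \<in> I \<Longrightarrow> antisymmetric_row (R v)"
  shows "(\<Sum>t\<in>Pow T. fdet (U \<times> UNIV) (swap_rows t R)) = 0"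
proof -
  have "finite T" using assms(1,2) by (rule rev_finite_subset)
  then show ?thesis using assms(2-)
  \<comment> \<open>Passing from \<open>insert w T\<close> to \<open>T\<close> raises the size of
    the complement by one; the row that becomes antisymmetric enlarges \<open>I\<close> by one and
    keeps the inequality. The matrix changes as well, so \<open>I\<close> and \<open>R\<close> stay
    arbitrary.\<close>
  proof (induction T arbitrary: I R rule: finite_induct)
    case empty
    then show ?case using fdet_eq_0_of_antisymmetric_rows[OF assms(1), of I R] by simp
  next
    case (insert w T)
    let ?V = "U \<times> (UNIV :: bit set)"
    let ?a = "(w, 0) :: _ \<times> bit" and ?b = "(w, 1) :: _ \<times> bit"
    have V: "finite ?V" "?a \<in> ?V" "?b \<in> ?V" using assms(1) insert.prems(1) by auto
    define p q p' q' where "p = R ?a" "q = R ?b" "p' = (\<lambda>x. p (mirror x))" "q' = (\<lambda>x. q (mirror x))"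
    note pq = this
    define R1 R2 where "R1 = R(?b := \<lambda>x. q x - q' x)" "R2 = R(?b := q', ?a := \<lambda>x. p x - p' x)"
    note R12 = this
    have split: "fdet ?V (swap_rows t R) + fdet ?V (swap_rows (insert w t) R)
        = fdet ?V (swap_rows t R1) + fdet ?V (swap_rows t R2)" if t: "t \<in> Pow T" for t
    proof -
      have w: "w \<notin> t" using t insert.hyps(2) by auto
      define B where "B = swap_rows t R"
      have B: "B ?a = p" "B ?b = q" using w by (auto simp: B_def swap_rows_def pq)
      then have "B(?a := p) = B" "B(?b := q) = B" by (auto simp: fun_upd_idem)
      have "fdet ?V (swap_rows (insert w t) R) = fdet ?V (B(?a := q', ?b := p'))"
        using swap_rows_insert[OF w, of R 0] by (simp add: B_def pq)
      \<comment> \<open>The reflected rows arrive in exchanged order; putting them back produces the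
        sign.\<close>
      also have "\<dots> = - fdet ?V (B(?b := q', ?a := p'))"
        using fdet_swap_two_rows[OF V, of B q' p'] by (simp add: fun_upd_twist)
      finally have 1: "fdet ?V (swap_rows (insert w t) R) = - fdet ?V (B(?b := q', ?a := p'))" .
      have 2: "fdet ?V (swap_rows t R1) = fdet ?V B - fdet ?V (B(?b := q'))"
        using fdet_row_diff[OF V(1,3), of B q q'] w \<open>B(?b := q) = B\<close>
        by (simp add: R12 swap_rows_upd B_def)
      have "B(?b := q', ?a := p) = B(?b := q')"
        by (rule fun_upd_idem) (simp add: B)
      then have 3: "fdet ?V (swap_rows t R2) = fdet ?V (B(?b := q')) - fdet ?V (B(?b := q', ?a := p'))"
        using fdet_row_diff[OF V(1,2), of "B(?b := q')" p p'] w
        by (simp add: R12 swap_rows_upd B_def)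
      show ?thesis using 1 2 3 by (simp add: B_def)
    qed
    have I: "I \<subseteq> (U - T) \<times> UNIV" "?a \<notin> I" "?b \<notin> I" "finite I"
      using insert.prems(2) assms(1) by (auto intro: finite_subset)
    have "U - T = insert w (U - insert w T)" using insert.hyps(2) insert.prems(1) by auto
    then have "card (U - T) = card (insert w (U - insert w T))" by (rule arg_cong)
    also have "\<dots> = Suc (card (U - insert w T))"
      using assms(1) by (intro card_insert_disjoint) auto
    finally have card: "card (U - T) < Suc (card I)"
      using insert.prems(3) by linarith
    have "(\<Sum>t\<in>Pow T. fdet ?V (swap_rows t R1)) = 0"
    proof (rule insert.IH)
      show "antisymmetric_row (R1 v)" if "v \<in> insert ?b I" for v
        using that I insert.prems(4) antisymmetric_row_diff_mirror[of q] by (auto simp: R12 pq(4))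
    qed (use I card insert.prems(1) insert.hyps(2) in auto)
    moreover have "(\<Sum>t\<in>Pow T. fdet ?V (swap_rows t R2)) = 0"
    proof (rule insert.IH)
      show "antisymmetric_row (R2 v)" if "v \<in> insert ?a I" for v
        using that I insert.prems(4) antisymmetric_row_diff_mirror[of p] by (auto simp: R12 pq(3))
    qed (use I card insert.prems(1) insert.hyps(2) in auto)
    ultimately show ?case
      using insert.hyps split by (simp add: sum_Pow_insert sum.distrib)
  qed
qed

text \<open>With \<open>p\<close> antisymmetric, the reflection above \<open>u\<close> turns
  \<open>p \<and> q\<close> into \<open>q' \<and> p' = - (q' \<and> p) = p \<and> q'\<close>. The
  difference \<open>p \<and> (q - q')\<close> has one antisymmetric row more than
  \<open>U - T\<close> has vertices, so its sum over the reflections vanishes.\<close>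

lemma sum_fdet_swap_rows_flip:
  assumes "finite U" "T \<subseteq> U" "u \<in> U - T"
    and anti: "\<And>v. v \<in> U - T \<Longrightarrow> antisymmetric_row (R (v, s v))"
  shows "(\<Sum>t\<in>Pow T. fdet (U \<times> UNIV) (swap_rows t (swap_rows {u} R)))
       = (\<Sum>t\<in>Pow T. fdet (U \<times> UNIV) (swap_rows t R))"
proof -
  let ?V = "U \<times> (UNIV :: bit set)"
  let ?a = "(u, s u)" and ?b = "(u, 1 - s u)"
  have V: "finite ?V" "?a \<in> ?V" "?b \<in> ?V" "?a \<noteq> ?b" using assms(1,3) by auto
  define p q q' where "p = R ?a" "q = R ?b" "q' = (\<lambda>x. q (mirror x))"
  note pq = this
  have p: "(\<lambda>x. p (mirror x)) = (\<lambda>x. - p x)"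
    using anti[OF assms(3)] unfolding antisymmetric_row_def pq by (intro ext) blast
  define R1 where "R1 = R(?b := \<lambda>x. q x - q' x)"
  have split: "fdet ?V (swap_rows t R1)
      = fdet ?V (swap_rows t R) - fdet ?V (swap_rows t (swap_rows {u} R))"
    if t: "t \<in> Pow T" for t
  proof -
    have u: "u \<notin> t" using t assms(3) by auto
    define B where "B = swap_rows t R"
    have B: "B ?a = p" "B ?b = q" using u by (auto simp: B_def swap_rows_def pq)
    have "swap_rows t (swap_rows {u} R) = B(?a := q', ?b := \<lambda>x. - p x)"
      using swap_rows_insert[of u "{}" R "s u"] u
      by (simp add: swap_rows_upd B_def pq p[unfolded pq])
    then have "fdet ?V (swap_rows t (swap_rows {u} R)) = fdet ?V (B(?b := q', ?a := p))"
      using fdet_row_uminus[OF V(1,3), of "B(?a := q')" p] fdet_swap_two_rows[OF V, of B q' p] V(4)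
      by (simp add: fun_upd_twist)
    moreover have "B(?b := q', ?a := p) = B(?b := q')"
      by (rule fun_upd_idem) (simp add: B)
    moreover have "fdet ?V (swap_rows t R1) = fdet ?V (B(?b := q)) - fdet ?V (B(?b := q'))"
      using fdet_row_diff[OF V(1,3), of B q q'] u by (simp add: R1_def swap_rows_upd B_def)
    moreover have "B(?b := q) = B" using B(2) by auto
    ultimately show ?thesis by (simp add: B_def)
  qed
  have "(\<Sum>t\<in>Pow T. fdet ?V (swap_rows t R1)) = 0"
  proof (rule sum_fdet_swap_rows_eq_0[OF assms(1,2)])
    let ?I = "insert ?b ((\<lambda>v. (v, s v)) ` (U - T))"
    show "?I \<subseteq> (U - T) \<times> UNIV" using assms(3) by auto
    have "card ((\<lambda>v. (v, s v)) ` (U - T)) = card (U - T)"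
      by (rule card_image) (auto simp: inj_on_def)
    then show "card (U - T) < card ?I" using assms(1) by (subst card_insert_disjoint) auto
    show "antisymmetric_row (R1 v)" if "v \<in> ?I" for v
      using that anti antisymmetric_row_diff_mirror[of q] by (auto simp: R1_def pq(3))
  qed
  then show ?thesis using split by (simp add: sum_subtractf)
qed

section \<open>Forests of the strong product\<close>

text \<open>A closed walk of positive length contains a cycle, so a cycle exists exactly when some
  vertex reaches itself.\<close>

lemma (in wf_digraph) forest_iff_acyclic: "forest G \<longleftrightarrow> acyclic (arcs_ends G)"
proof -
  have "(\<exists>p. cycle p) \<longleftrightarrow> (\<exists>u. u \<rightarrow>\<^sup>+ u)"
  proof
    assume "\<exists>p. cycle p"
    then show "\<exists>u. u \<rightarrow>\<^sup>+ u" unfolding cycle_def reachable1_awalk by blast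
  next
    assume "\<exists>u. u \<rightarrow>\<^sup>+ u"
    then obtain p where "closed_w p" unfolding reachable1_awalk closed_w_def by auto
    then show "\<exists>p. cycle p" by (rule closed_w_imp_cycle)
  qed
  then show ?thesis unfolding forest_def acyclic_def by blast
qed

text \<open>The arc part of the automorphism of the product that acts as \<open>mirror\<close> on
  vertices. The level belongs to the tail in two cases and to the head in the third, but the
  reflection flips either.\<close>

fun mirror_arc :: "('a, 'b) prod_arc \<Rightarrow> ('a, 'b) prod_arc" where
  "mirror_arc (Straight a \<epsilon>) = Straight a (1 - \<epsilon>)"
| "mirror_arc (Diagonal a \<epsilon>) = Diagonal a (1 - \<epsilon>)"
| "mirror_arc (Vertical u \<epsilon>) = Vertical u (1 - \<epsilon>)"

lemma mirror_arc_mirror_arc [simp]: "mirror_arc (mirror_arc e) = e"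
  by (cases e) auto

section \<open>Vertices and arcs of the product\<close>

context
  fixes G :: "('a, 'b) pre_digraph"
  assumes fin: "fin_digraph G"
begin

private abbreviation (input) "H \<equiv> strong_prod_K2 G"

lemma verts_H: "verts H = verts G \<times> UNIV"
  by (simp add: strong_prod_K2_def UNIV_bit)

lemma mem_arcs_H [simp]:
  "Straight a \<epsilon> \<in> arcs H \<longleftrightarrow> a \<in> arcs G"
  "Diagonal a \<epsilon> \<in> arcs H \<longleftrightarrow> a \<in> arcs G"
  "Vertical u \<epsilon> \<in> arcs H \<longleftrightarrow> u \<in> verts G"
  by (cases \<epsilon>; auto simp: strong_prod_K2_def)+

lemma tail_H [simp]:
  "tail H (Straight a \<epsilon>) = (tail G a, \<epsilon>)"
  "tail H (Diagonal a \<epsilon>) = (tail G a, \<epsilon>)"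
  "tail H (Vertical u \<epsilon>) = (u, 1 - \<epsilon>)"
  by (simp_all add: strong_prod_K2_def)

lemma head_H [simp]:
  "head H (Straight a \<epsilon>) = (head G a, \<epsilon>)"
  "head H (Diagonal a \<epsilon>) = (head G a, 1 - \<epsilon>)"
  "head H (Vertical u \<epsilon>) = (u, \<epsilon>)"
  by (simp_all add: strong_prod_K2_def)

lemma mirror_arc_ends [simp]:
  "tail H (mirror_arc e) = mirror (tail H e)"
  "head H (mirror_arc e) = mirror (head H e)"
  "mirror_arc e \<in> arcs H \<longleftrightarrow> e \<in> arcs H"
  by (cases e; simp)+

lemma finite_verts_H [simp]: "finite (verts H)"
  using fin by (simp add: verts_H fin_digraph.finite_verts)

lemma finite_arcs_H: "finite (arcs H)"
proof -
  have "arcs H = (\<lambda>(a, \<epsilon>). Straight a \<epsilon>) ` (arcs G \<times> UNIV) \<union> (\<lambda>(a, \<epsilon>). Diagonal a \<epsilon>) ` (arcs G \<times> UNIV)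
      \<union> (\<lambda>(u, \<epsilon>). Vertical u \<epsilon>) ` (verts G \<times> UNIV)"
    by (auto simp: strong_prod_K2_def image_iff UNIV_bit)
  then show ?thesis
    using fin by (simp add: fin_digraph.finite_verts fin_digraph.finite_arcs)
qed

lemma wf_digraph_H: "wf_digraph H"
proof
  interpret fin_digraph G by (fact fin)
  show "tail H e \<in> verts H" "head H e \<in> verts H" if "e \<in> arcs H" for e
    using that by (cases e; auto simp: verts_H)+
qed

section \<open>Spanning subgraphs as sets of arcs\<close>

definition arc_graph :: "('a, 'b) prod_arc set \<Rightarrow> ('a \<times> bit, ('a, 'b) prod_arc) pre_digraph" where
  "arc_graph X = \<lparr>verts = verts H, arcs = X, tail = tail H, head = head H\<rparr>"

lemma arc_graph_simps [simp]:
  "verts (arc_graph X) = verts H" "arcs (arc_graph X) = X"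
  "tail (arc_graph X) = tail H" "head (arc_graph X) = head H"
  by (simp_all add: arc_graph_def)

lemma inj_arc_graph: "inj arc_graph"
  by (rule injI) (metis arc_graph_simps(2))

lemma wf_digraph_arc_graph: "X \<subseteq> arcs H \<Longrightarrow> wf_digraph (arc_graph X)"
  using wf_digraph_H by (auto simp: wf_digraph_def)

lemma mem_arcs_ends: "(v, x) \<in> arcs_ends (arc_graph X) \<longleftrightarrow> (\<exists>e\<in>X. tail H e = v \<and> head H e = x)"
  by (auto simp: arcs_ends_def arc_to_ends_def)

text \<open>Spanning subgraphs inherit both end maps, so their arc sets determine them and counting
  forests becomes counting arc sets. Out-degree at most one says that no two arcs share a
  tail.\<close>

lemma rooted_forest_iff:
  "rooted_forest H F \<longleftrightarrow> (\<exists>X. F = arc_graph X \<and> X \<subseteq> arcs H \<and> inj_on (tail H) X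
     \<and> acyclic (arcs_ends (arc_graph X)))"
proof -
  have deg: "(\<forall>v\<in>verts H. out_degree (arc_graph X) v \<le> 1) \<longleftrightarrow> inj_on (tail H) X"
    if X: "X \<subseteq> arcs H" for X
  proof -
    have f: "finite {e \<in> X. tail H e = v}" for v
      using X finite_arcs_H by (auto intro: finite_subset)
    have "(\<forall>v\<in>verts H. out_degree (arc_graph X) v \<le> 1)
        \<longleftrightarrow> (\<forall>v\<in>verts H. \<forall>e\<in>X. \<forall>e'\<in>X. tail H e = v \<longrightarrow> tail H e' = v \<longrightarrow> e = e')"
      using f by (auto simp: out_degree_def out_arcs_def card_le_Suc0_iff_eq)
    then show ?thesis
      using X wf_digraph.tail_in_verts[OF wf_digraph_H] unfolding inj_on_def by blast
  qed
  have "spanning F H \<longleftrightarrow> (\<exists>X. F = arc_graph X \<and> X \<subseteq> arcs H)"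
  proof
    assume "spanning F H"
    then have "F = arc_graph (arcs F)" "arcs F \<subseteq> arcs H"
      by (auto simp: spanning_def subgraph_def compatible_def)
    then show "\<exists>X. F = arc_graph X \<and> X \<subseteq> arcs H" by blast
  next
    assume "\<exists>X. F = arc_graph X \<and> X \<subseteq> arcs H"
    then show "spanning F H"
      using wf_digraph_H wf_digraph_arc_graph
      by (auto simp: spanning_def subgraph_def compatible_def)
  qed
  then show ?thesis
    unfolding rooted_forest_def
    using deg wf_digraph.forest_iff_acyclic[OF wf_digraph_arc_graph]
    by (metis arc_graph_simps(1))
qed

text \<open>Identity minus adjacency matrix; the row of \<open>v\<close> depends only on the arcs
  leaving \<open>v\<close>. Parallel arcs count once, and none occur when the tail map is injective
  on \<open>X\<close>.\<close>

definition arc_row :: "('a, 'b) prod_arc set \<Rightarrow> 'a \<times> bit \<Rightarrow> 'a \<times> bit \<Rightarrow> real" where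
  "arc_row X v x = of_bool (x = v) - of_bool ((v, x) \<in> arcs_ends (arc_graph X))"

lemma fdet_arc_row:
  assumes "X \<subseteq> arcs H" "inj_on (tail H) X"
  shows "fdet (verts G \<times> UNIV) (arc_row X) = of_bool (acyclic (arcs_ends (arc_graph X)))"
  unfolding arc_row_def verts_H[symmetric]
proof (rule fdet_functional_digraph)
  have "tail H e \<in> verts H" "head H e \<in> verts H" if "e \<in> X" for e
    using that assms(1) wf_digraph_H unfolding wf_digraph_def by blast+
  then show "arcs_ends (arc_graph X) \<subseteq> verts H \<times> verts H"
    by (intro subrelI) (metis mem_arcs_ends mem_Sigma_iff)
  show "single_valued (arcs_ends (arc_graph X))"
    using assms(2) unfolding single_valued_def mem_arcs_ends by (metis inj_onD)
qed simp

text \<open>The vertical arc of spin \<open>1 - \<epsilon>\<close> starts at level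
  \<open>\<epsilon>\<close> and is the only arc leaving there. The row is therefore the indicator of
  \<open>(u, \<epsilon>)\<close> minus that of its mirror image.\<close>

lemma antisymmetric_arc_row:
  assumes "inj_on (tail H) X" "Vertical u (1 - \<epsilon>) \<in> X"
  shows "antisymmetric_row (arc_row X (u, \<epsilon>))"
proof -
  have "((u, \<epsilon>), x) \<in> arcs_ends (arc_graph X) \<longleftrightarrow> x = (u, 1 - \<epsilon>)" for x
  proof
    assume "((u, \<epsilon>), x) \<in> arcs_ends (arc_graph X)"
    then obtain e where e: "e \<in> X" "tail H e = (u, \<epsilon>)" "head H e = x" by (auto simp: mem_arcs_ends)
    then have "e = Vertical u (1 - \<epsilon>)" using assms inj_onD[OF assms(1), of e "Vertical u (1 - \<epsilon>)"] by simp
    then show "x = (u, 1 - \<epsilon>)" using e by simp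
  qed (use assms(2) in \<open>force simp: mem_arcs_ends\<close>)
  then have row: "arc_row X (u, \<epsilon>) x = of_bool (x = (u, \<epsilon>)) - of_bool (x = mirror (u, \<epsilon>))" for x
    by (simp add: arc_row_def)
  have "mirror x = (u, \<epsilon>) \<longleftrightarrow> x = mirror (u, \<epsilon>)" for x
    by (metis mirror_mirror)
  then show ?thesis
    unfolding antisymmetric_row_def row mirror_eq_iff by simp
qed

section \<open>Reflecting the arcs that leave chosen pairs of vertices\<close>

definition swap_arc :: "'a set \<Rightarrow> ('a, 'b) prod_arc \<Rightarrow> ('a, 'b) prod_arc" where
  "swap_arc t e = (if fst (tail H e) \<in> t then mirror_arc e else e)"

text \<open>Reflection keeps the first coordinate of the tail, so an arc and its image are both
  subject to it or both not. This makes \<open>swap_arc t\<close> an involution.\<close>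

lemma swap_arc_simps [simp]:
  "fst (tail H (swap_arc t e)) = fst (tail H e)"
  "swap_arc t (swap_arc t e) = e"
  "swap_arc t e \<in> arcs H \<longleftrightarrow> e \<in> arcs H"
  by (auto simp: swap_arc_def)

lemma inj_swap_arc: "inj (swap_arc t)"
  by (rule injI) (metis swap_arc_simps(2))

lemma mem_swap_arc_image: "e \<in> swap_arc t ` X \<longleftrightarrow> swap_arc t e \<in> X"
  by (metis image_iff swap_arc_simps(2))

lemma swap_arc_image_image [simp]: "swap_arc t ` swap_arc t ` X = X"
  by (simp add: image_image)

lemma swap_arc_subset: "swap_arc t ` X \<subseteq> arcs H \<longleftrightarrow> X \<subseteq> arcs H"
  by (auto simp: image_subset_iff)

text \<open>The passage from arcs to matrices: for \<open>v\<close> above \<open>t\<close>, the arcs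
  leaving \<open>v\<close> afterwards are the mirror images of those that left
  \<open>mirror v\<close> before.\<close>

lemma arc_row_swap: "arc_row (swap_arc t ` X) = swap_rows t (arc_row X)"
proof (intro ext)
  fix v x
  have ends: "tail H (swap_arc t e) = v \<and> head H (swap_arc t e) = x \<longleftrightarrow>
      (if fst v \<in> t then tail H e = mirror v \<and> head H e = mirror x else tail H e = v \<and> head H e = x)"
    for e
  proof (cases "fst (tail H e) = fst v")
    case True
    then show ?thesis by (simp add: swap_arc_def mirror_eq_swap)
  next
    case False
    then have "tail H e \<noteq> v" "tail H e \<noteq> mirror v" "tail H (swap_arc t e) \<noteq> v"
      using swap_arc_simps(1)[of t e] fst_mirror[of v] by metis+
    then show ?thesis by simp
  qed
  have "(v, x) \<in> arcs_ends (arc_graph (swap_arc t ` X)) \<longleftrightarrow>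
      (\<exists>e\<in>X. tail H (swap_arc t e) = v \<and> head H (swap_arc t e) = x)"
    by (simp add: mem_arcs_ends)
  also have "\<dots> \<longleftrightarrow> (if fst v \<in> t then (mirror v, mirror x) \<in> arcs_ends (arc_graph X)
      else (v, x) \<in> arcs_ends (arc_graph X))"
    unfolding ends mem_arcs_ends by simp
  finally show "arc_row (swap_arc t ` X) v x = swap_rows t (arc_row X) v x"
    by (simp add: arc_row_def swap_rows_def)
qed

text \<open>Two arcs with a common tail are reflected together or not at all.\<close>

lemma inj_on_tail_swap:
  assumes "inj_on (tail H) X" shows "inj_on (tail H) (swap_arc t ` X)"
proof (rule inj_onI)
  fix e e' assume e: "e \<in> swap_arc t ` X" "e' \<in> swap_arc t ` X" "tail H e = tail H e'"
  then have "tail H (swap_arc t e) = tail H (swap_arc t e')" by (auto simp: swap_arc_def)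
  then have "swap_arc t e = swap_arc t e'"
    using e(1,2) inj_onD[OF assms] unfolding mem_swap_arc_image by blast
  then show "e = e'" by (rule injD[OF inj_swap_arc])
qed

lemma card_swap_straight:
  "card {e \<in> swap_arc t ` X. \<exists>\<epsilon>. e = Straight a \<epsilon>} = card {e \<in> X. \<exists>\<epsilon>. e = Straight a \<epsilon>}"
proof -
  have "(\<exists>\<epsilon>. swap_arc t e = Straight a \<epsilon>) \<longleftrightarrow> (\<exists>\<epsilon>. e = Straight a \<epsilon>)" for e
    by (cases e) (auto simp: swap_arc_def)
  then have "{e \<in> swap_arc t ` X. \<exists>\<epsilon>. e = Straight a \<epsilon>} = swap_arc t ` {e \<in> X. \<exists>\<epsilon>. e = Straight a \<epsilon>}"
    by auto
  then show ?thesis using card_image[OF inj_on_subset[OF inj_swap_arc]] by simp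
qed

lemma card_swap_diagonal:
  "card {e \<in> swap_arc t ` X. \<exists>\<epsilon>. e = Diagonal a \<epsilon>} = card {e \<in> X. \<exists>\<epsilon>. e = Diagonal a \<epsilon>}"
proof -
  have "(\<exists>\<epsilon>. swap_arc t e = Diagonal a \<epsilon>) \<longleftrightarrow> (\<exists>\<epsilon>. e = Diagonal a \<epsilon>)" for e
    by (cases e) (auto simp: swap_arc_def)
  then have "{e \<in> swap_arc t ` X. \<exists>\<epsilon>. e = Diagonal a \<epsilon>} = swap_arc t ` {e \<in> X. \<exists>\<epsilon>. e = Diagonal a \<epsilon>}"
    by auto
  then show ?thesis using card_image[OF inj_on_subset[OF inj_swap_arc]] by simp
qed

lemma Vertical_mem_swap:
  "Vertical u \<epsilon> \<in> swap_arc t ` X \<longleftrightarrow> Vertical u (if u \<in> t then 1 - \<epsilon> else \<epsilon>) \<in> X"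
  unfolding mem_swap_arc_image by (simp add: swap_arc_def)

lemma vertical_set_swap: "vertical_set (arc_graph (swap_arc t ` X)) = vertical_set (arc_graph X)"
proof -
  have "(\<exists>\<epsilon>. Vertical u (if u \<in> t then 1 - \<epsilon> else \<epsilon>) \<in> X) \<longleftrightarrow> (\<exists>\<epsilon>. Vertical u \<epsilon> \<in> X)" for u
  proof
    assume "\<exists>\<epsilon>. Vertical u \<epsilon> \<in> X"
    then obtain \<epsilon> where "Vertical u \<epsilon> \<in> X" ..
    then have "Vertical u (if u \<in> t then 1 - (if u \<in> t then 1 - \<epsilon> else \<epsilon>) else (if u \<in> t then 1 - \<epsilon> else \<epsilon>)) \<in> X"
      by (cases "u \<in> t") (simp_all only: one_minus_bit if_True if_False)
    then show "\<exists>\<epsilon>. Vertical u (if u \<in> t then 1 - \<epsilon> else \<epsilon>) \<in> X" by blast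
  qed blast
  then show ?thesis by (simp only: vertical_set_def arc_graph_simps Vertical_mem_swap)
qed

text \<open>Reflection changes only the level of an arc, never its kind or its origin in
  \<open>G\<close>.\<close>

lemma same_projection_swap:
  "same_projection G (arc_graph (swap_arc t ` X)) F \<longleftrightarrow> same_projection G (arc_graph X) F"
  by (simp add: same_projection_def card_swap_straight card_swap_diagonal vertical_set_swap)

section \<open>Counting forests with prescribed spins\<close>

context
  fixes F\<^sub>0 :: "('a \<times> bit, ('a, 'b) prod_arc) pre_digraph"
  assumes vertical_set_F\<^sub>0: "vertical_set F\<^sub>0 \<subseteq> verts G"
begin

private abbreviation (input) "S \<equiv> vertical_set F\<^sub>0"

text \<open>Acyclicity is left out because reflections need not preserve it, whereas they map this
  set to a set of the same form. Both vertical arcs at a vertex may be present; they form a cycle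
  and drop out in \<open>forests\<close>.\<close>

definition configs :: "('a \<Rightarrow> bit) \<Rightarrow> ('a, 'b) prod_arc set set" where
  "configs s = {X. X \<subseteq> arcs H \<and> inj_on (tail H) X \<and> same_projection G (arc_graph X) F\<^sub>0
     \<and> (\<forall>u\<in>S. Vertical u (s u) \<in> X)}"

lemma finite_configs: "finite (configs s)"
  by (rule finite_subset[of _ "Pow (arcs H)"]) (auto simp: configs_def finite_arcs_H)

lemma swap_mem_configs:
  assumes "\<And>u. u \<in> S \<Longrightarrow> s' u = (if u \<in> t then 1 - s u else s u)" "X \<in> configs s"
  shows "swap_arc t ` X \<in> configs s'"
proof -
  have "Vertical u (s' u) \<in> swap_arc t ` X" if "u \<in> S" for u
  proof -
    have "(if u \<in> t then 1 - s' u else s' u) = s u"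
      using assms(1)[OF that] by (cases "u \<in> t") (simp_all only: one_minus_bit if_True if_False)
    then show ?thesis using assms(2) that unfolding Vertical_mem_swap configs_def by auto
  qed
  then show ?thesis
    using assms(2) unfolding configs_def mem_Collect_eq swap_arc_subset same_projection_swap
    by (blast intro: inj_on_tail_swap)
qed

text \<open>The involution flips the prescribed spins exactly at the vertices of \<open>S\<close>
  lying in \<open>t\<close>. For \<open>t\<close> disjoint from \<open>S\<close> it therefore
  permutes \<open>configs s\<close>.\<close>

lemma bij_betw_swap_configs:
  assumes "\<And>u. u \<in> S \<Longrightarrow> s' u = (if u \<in> t then 1 - s u else s u)"
  shows "bij_betw (image (swap_arc t)) (configs s) (configs s')"
proof (rule bij_betw_byWitness[where f' = "image (swap_arc t)"])
  have "s u = (if u \<in> t then 1 - s' u else s' u)" if "u \<in> S" for u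
    using assms[OF that] by (cases "u \<in> t") (simp_all only: one_minus_bit if_True if_False)
  then show "image (swap_arc t) ` configs s' \<subseteq> configs s"
    using swap_mem_configs by blast
  show "image (swap_arc t) ` configs s \<subseteq> configs s'"
    using swap_mem_configs assms by blast
qed simp_all

definition forests :: "('a \<Rightarrow> bit) \<Rightarrow> ('a, 'b) prod_arc set set" where
  "forests s = {X \<in> configs s. acyclic (arcs_ends (arc_graph X))}"

lemma card_forests: "real (card (forests s)) = (\<Sum>X\<in>configs s. fdet (verts G \<times> UNIV) (arc_row X))"
proof -
  have "(\<Sum>X\<in>configs s. fdet (verts G \<times> UNIV) (arc_row X))
      = (\<Sum>X\<in>configs s. of_bool (acyclic (arcs_ends (arc_graph X))))"
    by (intro sum.cong) (auto simp: configs_def fdet_arc_row)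
  also have "\<dots> = real (card (forests s))"
    using finite_configs by (simp add: forests_def sum.If_cases of_bool_def Int_def)
  finally show ?thesis ..
qed

text \<open>After exchanging the sums, each of the \<open>2 ^ card T\<close> reflections merely
  permutes the configurations and reproduces the determinant sum that counts the forests.\<close>

lemma sum_swaps_configs:
  assumes T: "T = verts G - S"
  shows "(\<Sum>X\<in>configs s. \<Sum>t\<in>Pow T. fdet (verts G \<times> UNIV) (swap_rows t (arc_row X)))
       = 2 ^ card T * real (card (forests s))"
proof -
  have "finite T" using fin T by (simp add: fin_digraph.finite_verts)
  have "(\<Sum>X\<in>configs s. \<Sum>t\<in>Pow T. fdet (verts G \<times> UNIV) (swap_rows t (arc_row X)))
      = (\<Sum>t\<in>Pow T. \<Sum>X\<in>configs s. fdet (verts G \<times> UNIV) (arc_row (swap_arc t ` X)))"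
    unfolding arc_row_swap by (rule sum.swap)
  also have "\<dots> = (\<Sum>t\<in>Pow T. real (card (forests s)))"
  proof (rule sum.cong[OF refl])
    fix t assume "t \<in> Pow T"
    then have "bij_betw (image (swap_arc t)) (configs s) (configs s)"
      using T by (intro bij_betw_swap_configs) auto
    from sum.reindex_bij_betw[OF this]
    show "(\<Sum>X\<in>configs s. fdet (verts G \<times> UNIV) (arc_row (swap_arc t ` X))) = real (card (forests s))"
      unfolding card_forests .
  qed
  also have "\<dots> = 2 ^ card T * real (card (forests s))"
    using \<open>finite T\<close> by (simp add: card_Pow)
  finally show ?thesis .
qed

text \<open>Reflecting above \<open>u\<close> matches the configurations of both sides but need not
  preserve acyclicity. What agrees for each configuration is the determinant sum over all
  reflections above \<open>T\<close>, by \<open>sum_fdet_swap_rows_flip\<close>; the factor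
  \<open>2 ^ card T\<close> cancels.\<close>

lemma card_forests_flip:
  assumes "u \<in> S"
  shows "card (forests (s(u := 1 - s u))) = card (forests s)"
proof -
  define T where "T = verts G - S"
  let ?s = "s(u := 1 - s u)"
  let ?V = "verts G \<times> (UNIV :: bit set)"
  have V: "finite (verts G)" "T \<subseteq> verts G" "u \<in> verts G - T" "verts G - T = S"
    using fin vertical_set_F\<^sub>0 assms by (auto simp: T_def fin_digraph.finite_verts)
  have "bij_betw (image (swap_arc {u})) (configs s) (configs ?s)"
    by (rule bij_betw_swap_configs) auto
  from sum.reindex_bij_betw[OF this, of "\<lambda>Y. \<Sum>t\<in>Pow T. fdet ?V (arc_row (swap_arc t ` Y))"]
  have "2 ^ card T * real (card (forests ?s))
      = (\<Sum>X\<in>configs s. \<Sum>t\<in>Pow T. fdet ?V (swap_rows t (swap_rows {u} (arc_row X))))"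
    unfolding sum_swaps_configs[OF T_def, symmetric] arc_row_swap[symmetric] by (rule sym)
  also have "\<dots> = (\<Sum>X\<in>configs s. \<Sum>t\<in>Pow T. fdet ?V (swap_rows t (arc_row X)))"
  proof (rule sum.cong[OF refl], rule sum_fdet_swap_rows_flip[OF V(1-3)])
    fix X v assume "X \<in> configs s" "v \<in> verts G - T"
    \<comment> \<open>A vertical arc of spin \<open>s v\<close> has its tail at level
      \<open>1 - s v\<close>, and the antisymmetric row is that of the tail.\<close>
    then show "antisymmetric_row (arc_row X (v, 1 - s v))"
      unfolding V(4) by (intro antisymmetric_arc_row) (auto simp: configs_def)
  qed
  also have "\<dots> = 2 ^ card T * real (card (forests s))"
    by (rule sum_swaps_configs[OF T_def])
  finally show ?thesis by simp
qed

text \<open>The spins on which \<open>s\<close> and \<open>s'\<close> disagree are flipped one after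
  the other; values outside \<open>S\<close> do not enter \<open>configs\<close>.\<close>

lemma card_forests_eq: "card (forests s) = card (forests s')"
proof -
  define W where "W = {u \<in> S. s u \<noteq> s' u}"
  have "finite W"
    using fin vertical_set_F\<^sub>0 by (auto simp: W_def fin_digraph.finite_verts intro: finite_subset)
  moreover have "{u \<in> S. s u \<noteq> s' u} = W" by (simp add: W_def)
  ultimately show ?thesis
  proof (induction W arbitrary: s rule: finite_induct)
    case empty
    then have "configs s = configs s'" by (auto simp: configs_def)
    then show ?case by (simp add: forests_def)
  next
    case (insert w W)
    have "w \<in> {u \<in> S. s u \<noteq> s' u}" unfolding insert.prems by blast
    then have w: "w \<in> S" "s' w \<noteq> s w" by auto
    then have "s' w = 1 - s w" by (simp only: bit_neq_iff)
    then have "(s(w := 1 - s w)) u \<noteq> s' u \<longleftrightarrow> s u \<noteq> s' u \<and> u \<noteq> w" for u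
      by (cases "u = w") auto
    then have "{u \<in> S. (s(w := 1 - s w)) u \<noteq> s' u} = {u \<in> S. s u \<noteq> s' u} - {w}" by blast
    also have "\<dots> = W" using insert.prems insert.hyps(2) by simp
    finally have "{u \<in> S. (s(w := 1 - s w)) u \<noteq> s' u} = W" .
    from insert.IH[OF this] show ?case using card_forests_flip[OF w(1)] by metis
  qed
qed

text \<open>Two vertical arcs at \<open>u\<close> would form a directed cycle, so exactly one is
  present and the description in \<open>spin\<close> picks it.\<close>

lemma spin_eq_iff:
  assumes "rooted_forest H F" "same_projection G F F\<^sub>0" "u \<in> S"
  shows "spin F u = \<epsilon> \<longleftrightarrow> Vertical u \<epsilon> \<in> arcs F"
proof -
  obtain X where X: "F = arc_graph X" "acyclic (arcs_ends F)"
    using assms(1) by (auto simp: rooted_forest_iff)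
  have "\<exists>\<delta>. Vertical u \<delta> \<in> X"
    using assms(2,3) X(1) by (auto simp: same_projection_def vertical_set_def)
  then obtain \<delta> where \<delta>: "Vertical u \<delta> \<in> X" by blast
  have "Vertical u (1 - \<delta>) \<notin> X"
  proof
    assume "Vertical u (1 - \<delta>) \<in> X"
    with \<delta> have "((u, 1 - \<delta>), (u, \<delta>)) \<in> arcs_ends F" "((u, \<delta>), (u, 1 - \<delta>)) \<in> arcs_ends F"
      unfolding X(1) mem_arcs_ends by force+
    then show False using X(2) by (meson acyclic_def r_into_trancl trancl_into_trancl)
  qed
  then have "Vertical u \<epsilon>' \<in> X \<longleftrightarrow> \<epsilon>' = \<delta>" for \<epsilon>'
    using \<delta> bit_neq_iff[of \<epsilon>' \<delta>] by (cases "\<epsilon>' = \<delta>") simp_all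
  then show ?thesis by (auto simp: spin_def X(1))
qed

text \<open>The default 0 outside \<open>S\<close> makes spin vectors elements of
  \<open>PiE_dflt\<close>, the set that carries the product measure \<open>Pi_pmf\<close>.\<close>

definition spins :: "('a \<times> bit, ('a, 'b) prod_arc) pre_digraph \<Rightarrow> 'a \<Rightarrow> bit" where
  "spins F u = (if u \<in> S then spin F u else 0)"

text \<open>The hypothesis fixes \<open>s\<close> to the default outside \<open>S\<close>: for any
  other \<open>s\<close> no forest has \<open>spins F = s\<close>, while \<open>forests s\<close>
  ignores the values there.\<close>

lemma forests_fiber:
  assumes "s \<in> PiE_dflt S 0 (\<lambda>_. UNIV)"
  shows "{F. rooted_forest H F \<and> same_projection G F F\<^sub>0 \<and> spins F = s} = arc_graph ` forests s"
proof -
  have eq: "spins F = s \<longleftrightarrow> (\<forall>u\<in>S. Vertical u (s u) \<in> arcs F)"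
    if "rooted_forest H F" "same_projection G F F\<^sub>0" for F
    using spin_eq_iff[OF that] assms by (auto simp: spins_def PiE_dflt_def fun_eq_iff)
  show ?thesis
  proof (intro Set.set_eqI iffI)
    fix F assume F: "F \<in> {F. rooted_forest H F \<and> same_projection G F F\<^sub>0 \<and> spins F = s}"
    then obtain X where "F = arc_graph X" "X \<subseteq> arcs H" "inj_on (tail H) X"
      "acyclic (arcs_ends (arc_graph X))"
      by (auto simp: rooted_forest_iff)
    then show "F \<in> arc_graph ` forests s" using F eq[of F] by (auto simp: forests_def configs_def)
  next
    fix F assume "F \<in> arc_graph ` forests s"
    then obtain X where X: "F = arc_graph X" "X \<in> forests s" by blast
    then have "rooted_forest H F" "same_projection G F F\<^sub>0"
      by (auto simp: rooted_forest_iff forests_def configs_def)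
    then show "F \<in> {F. rooted_forest H F \<and> same_projection G F F\<^sub>0 \<and> spins F = s}"
      using X eq[of F] by (auto simp: forests_def configs_def)
  qed
qed

end

end

section \<open>Distribution of the spins\<close>

text \<open>The fibres partition \<open>A\<close> into \<open>card B\<close> sets of size
  \<open>c\<close>, so all points of \<open>B\<close> receive the same mass.\<close>

lemma map_pmf_of_set_uniform:
  assumes "finite A" "A \<noteq> {}" "f ` A \<subseteq> B" "finite B"
    and "\<And>b. b \<in> B \<Longrightarrow> card {x \<in> A. f x = b} = c"
  shows "map_pmf f (pmf_of_set A) = pmf_of_set B"
proof (rule pmf_eqI)
  fix b
  have fibers: "card A = card B * c"
    using sum.group[OF assms(1,4,3), of "\<lambda>_. 1 :: nat"] assms(5) by simp
  then have "c \<noteq> 0" "B \<noteq> {}" using assms(1,2) by auto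
  have "pmf (map_pmf f (pmf_of_set A)) b = real (card (A \<inter> f -` {b})) / real (card A)"
    using assms(1,2) by (simp add: pmf_map measure_pmf_of_set)
  also have "\<dots> = pmf (pmf_of_set B) b"
  proof (cases "b \<in> B")
    case True
    then have "card (A \<inter> f -` {b}) = c" using assms(5) by (simp add: Int_def vimage_def)
    then show ?thesis
      using True fibers \<open>c \<noteq> 0\<close> \<open>B \<noteq> {}\<close> assms(4) by simp
  next
    case False
    then have "A \<inter> f -` {b} = {}" using assms(3) by auto
    then show ?thesis using False \<open>B \<noteq> {}\<close> assms(4) by simp
  qed
  finally show "pmf (map_pmf f (pmf_of_set A)) b = pmf (pmf_of_set B) b" .
qed

text \<open>Independence is a statement about the joint distribution and the marginals, and neither
  changes when \<open>f\<close> is moved from the measure into the variables. This criterion asks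
  for a nonempty index set, hence the case distinction.\<close>

lemma indep_vars_map_pmf:
  assumes "prob_space.indep_vars (measure_pmf (map_pmf f p)) (\<lambda>_. count_space UNIV) X I"
  shows "prob_space.indep_vars (measure_pmf p) (\<lambda>_. count_space UNIV) (\<lambda>i x. X i (f x)) I"
proof (cases "I = {}")
  case True
  then show ?thesis
    by (simp add: prob_space.indep_vars_def[OF measure_pmf.prob_space_axioms]
        prob_space.indep_sets_def[OF measure_pmf.prob_space_axioms])
next
  case False
  have "(\<lambda>x. \<lambda>i\<in>I. X i x) \<in> measurable (count_space UNIV) (\<Pi>\<^sub>M i\<in>I. count_space UNIV)"
    by (auto simp: space_PiM)
  then have "distr (measure_pmf (map_pmf f p)) (\<Pi>\<^sub>M i\<in>I. count_space UNIV) (\<lambda>x. \<lambda>i\<in>I. X i x)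
      = distr (measure_pmf p) (\<Pi>\<^sub>M i\<in>I. count_space UNIV) (\<lambda>x. \<lambda>i\<in>I. X i (f x))"
    by (simp add: map_pmf_rep_eq distr_distr o_def)
  moreover have "distr (measure_pmf (map_pmf f p)) (count_space UNIV) (X i)
      = distr (measure_pmf p) (count_space UNIV) (\<lambda>x. X i (f x))" for i
    by (simp add: map_pmf_rep_eq distr_distr o_def)
  ultimately show ?thesis
    using assms False by (simp add: prob_space.indep_vars_iff_distr_eq_PiM'[OF measure_pmf.prob_space_axioms])
qed

theorem theorem2p1:
  fixes G :: "('a, 'b) pre_digraph"
    and F\<^sub>0 :: "('a \<times> bit, ('a, 'b) prod_arc) pre_digraph"
  assumes "fin_digraph G"
    and "rooted_forest (strong_prod_K2 G) F\<^sub>0"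
  shows "prob_space.indep_vars (measure_pmf (random_forest G F\<^sub>0)) (\<lambda>_. count_space UNIV)
           (\<lambda>u F. spin F u) (vertical_set F\<^sub>0)
       \<and> (\<forall>u \<in> vertical_set F\<^sub>0.
            map_pmf (\<lambda>F. spin F u) (random_forest G F\<^sub>0) = pmf_of_set {0, 1})"
proof -
  let ?S = "vertical_set F\<^sub>0"
  let ?\<Omega> = "{F. rooted_forest (strong_prod_K2 G) F \<and> same_projection G F F\<^sub>0}"
  let ?B = "PiE_dflt ?S 0 (\<lambda>_. UNIV :: bit set)"
  let ?\<sigma> = "spins F\<^sub>0"
  obtain X\<^sub>0 where "F\<^sub>0 = arc_graph G X\<^sub>0" "X\<^sub>0 \<subseteq> arcs (strong_prod_K2 G)"
    using assms(2) by (auto simp: rooted_forest_iff[OF assms(1)])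
  then have S: "?S \<subseteq> verts G"
    using mem_arcs_H[OF assms(1)] by (auto simp: vertical_set_def arc_graph_simps[OF assms(1)])
  have finS: "finite ?S"
    using S assms(1) by (auto simp: fin_digraph.finite_verts intro: finite_subset)
  have "?\<Omega> \<subseteq> arc_graph G ` Pow (arcs (strong_prod_K2 G))"
    by (auto simp: rooted_forest_iff[OF assms(1)])
  then have fin: "finite ?\<Omega>"
    using finite_arcs_H[OF assms(1)] by (meson finite_Pow_iff finite_imageI finite_subset)
  have nonempty: "?\<Omega> \<noteq> {}" using assms(2) by (auto simp: same_projection_def)
  have "map_pmf ?\<sigma> (random_forest G F\<^sub>0) = pmf_of_set ?B"
    unfolding random_forest_def
  proof (rule map_pmf_of_set_uniform[OF fin nonempty])
    show "?\<sigma> ` ?\<Omega> \<subseteq> ?B" by (auto simp: spins_def[OF assms(1) S] PiE_dflt_def)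
    show "finite ?B" using finS by (intro finite_PiE_dflt) auto
    fix s assume "s \<in> ?B"
    then have "{F \<in> ?\<Omega>. ?\<sigma> F = s} = arc_graph G ` forests G F\<^sub>0 s"
      using forests_fiber[OF assms(1) S, of s] by auto
    \<comment> \<open>Every fibre is compared with the one over the constant spin vector 0.\<close>
    then show "card {F \<in> ?\<Omega>. ?\<sigma> F = s} = card (forests G F\<^sub>0 (\<lambda>_. 0))"
      using card_image[OF inj_on_subset[OF inj_arc_graph[OF assms(1)]]]
        card_forests_eq[OF assms(1) S, of s "\<lambda>_. 0"] by simp
  qed
  \<comment> \<open>The uniform distribution on a product set is the product of the uniform
    distributions.\<close>
  also have "\<dots> = Pi_pmf ?S 0 (\<lambda>_. pmf_of_set UNIV)"
    using finS by (subst Pi_pmf_of_set) auto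
  finally have map: "map_pmf ?\<sigma> (random_forest G F\<^sub>0) = Pi_pmf ?S 0 (\<lambda>_. pmf_of_set UNIV)" .
  \<comment> \<open>Coordinates are independent under the product measure, and their independence is
    pulled back along \<open>?\<sigma>\<close>.\<close>
  have "prob_space.indep_vars (measure_pmf (random_forest G F\<^sub>0)) (\<lambda>_. count_space UNIV)
      (\<lambda>u F. ?\<sigma> F u) ?S"
    by (rule indep_vars_map_pmf[where f = ?\<sigma> and X = "\<lambda>u f. f u"])
       (simp only: map indep_vars_Pi_pmf[OF finS])
  then have "prob_space.indep_vars (measure_pmf (random_forest G F\<^sub>0)) (\<lambda>_. count_space UNIV)
      (\<lambda>u F. spin F u) ?S"
    by (subst (asm) prob_space.indep_vars_cong[OF measure_pmf.prob_space_axioms refl _ refl, where Y = "\<lambda>u F. spin F u"])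
       (auto simp: spins_def[OF assms(1) S])
  moreover have "map_pmf (\<lambda>F. spin F u) (random_forest G F\<^sub>0) = pmf_of_set {0, 1}" if u: "u \<in> ?S" for u
  proof -
    have "map_pmf (\<lambda>F. spin F u) (random_forest G F\<^sub>0) = map_pmf (\<lambda>f. f u) (map_pmf ?\<sigma> (random_forest G F\<^sub>0))"
      using u by (simp add: map_pmf_comp spins_def[OF assms(1) S])
    also have "\<dots> = pmf_of_set {0, 1}"
      using u by (simp add: map Pi_pmf_component[OF finS] UNIV_bit)
    finally show ?thesis .
  qed
  ultimately show ?thesis by blast
qed

end
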